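(* Let $\mathcal W$ be a distinguished variety with respect to $\mathbb D^2$. (1) If $(\mathcal F,P,U)$ is a finite model triple that satisfies $\mathcal W\cap\mathbb D^2=\mathcal W_{P,U}\cap\mathbb D^2$, then $\mathcal W\cap\mathbb D^2=\mathcal W_{\Psi_{P,U}}\cap\mathbb D^2$. (2) Let $\Psi$ be a rational matrix-valued inner function such that $\mathcal W\cap\mathbb D^2=\mathcal W_\Psi\cap\mathbb D^2$. If $(\mathcal F,P,U)$ is a finite model triple such that $\Psi=\Psi_{P,U}$, then $\mathcal W\cap\mathbb D^2=\mathcal W_{P,U}\cap\mathbb D^2$.
   Context: $\mathbb D$ is the open unit disc, $\mathbb T$ the unit circle. A distinguished variety with respect to $\mathbb D^2$ is the zero set $\mathcal W$ in $\mathbb C^2$ of a polynomial in $\mathbb C[z_1,z_2]$ with $\mathcal W\cap\mathbb D^2\ne\emptyset$ and $\mathcal W\cap\partial\mathbb D^2=\mathcal W\cap\mathbb T^2$. A finite model triple $(\mathcal F,P,U)$ consists of a finite-dimensional Hilbert space $\mathcal F$, an orthogonal projection $P$ and a unitary $U$ on $\mathcal F$; $P^\perp=I-P$. Put $$\mathcal W_{P,U}=\{(z_1,z_2)\in\mathbb C^2:(z_1,z_2)\in\sigma_T(P^\perp U+z_1z_2PU,\,U^*P+z_1z_2U^*P^\perp)\},$$ where $\sigma_T$ denotes the joint spectrum (set of joint eigenvalues) of a commuting pair of matrices, and $$\Psi_{P,U}(z)=P(I_{\mathcal F}-zU^*P^\perp)^{-1}U^*P|_{\operatorname{Ran}P}\in\mathcal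 B(\operatorname{Ran}P),\quad z\in\mathbb D,$$ which is a rational inner function. A matrix-valued holomorphic function $\Psi$ on $\mathbb D$ is rational inner if $\Psi(z)=A+zB(I-zD)^{-1}C$ for some (finite) block unitary matrix $\begin{bmatrix}A&B\\C&D\end{bmatrix}$. Writing $\Psi=F/q$ with $F$ a matrix polynomial and $q$ a scalar polynomial such that no nonconstant factor of $q$ divides all entries of $F$ (the zeros of $q$ are outside $\overline{\mathbb D}$), $\mathcal W_\Psi=\{(z_1,z_2)\in\mathbb C^2:\det(F(z_1)-z_2q(z_1)I)=0\}$, so that $\mathcal W_\Psi\cap\mathbb D^2=\{(z_1,z_2)\in\mathbb D^2:\det(\Psi(z_1)-z_2I)=0\}$. *)

theory Defs
  imports
    "HOL-Analysis.Elementary_Metric_Spaces"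
    "Jordan_Normal_Form.Schur_Decomposition"
    "Jordan_Normal_Form.Gauss_Jordan_Elimination"
begin

section \<open>Distinguished varieties\<close>

abbreviation disc :: "complex set" where "disc \<equiv> ball 0 1"

abbreviation bidisc :: "(complex \<times> complex) set" where "bidisc \<equiv> disc \<times> disc"

abbreviation torus2 :: "(complex \<times> complex) set" where "torus2 \<equiv> sphere 0 1 \<times> sphere 0 1"

text \<open>A polynomial in two variables is an element of \<open>complex poly poly\<close>; the inner variable is
  \<open>z\<^sub>1\<close> and the outer variable is \<open>z\<^sub>2\<close>.\<close>

definition zero_set :: "complex poly poly \<Rightarrow> (complex \<times> complex) set" where
  "zero_set p = {(z1, z2). poly (poly p [:z2:]) z1 = 0}"

definition distinguished_variety :: "(complex \<times> complex) set \<Rightarrow> bool" where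
  "distinguished_variety W \<longleftrightarrow>
     (\<exists>p. W = zero_set p) \<and> W \<inter> bidisc \<noteq> {} \<and> W \<inter> frontier bidisc = W \<inter> torus2"


section \<open>Rational matrix-valued inner functions and their varieties\<close>

definition unitary_mat :: "nat \<Rightarrow> complex mat \<Rightarrow> bool" where
  "unitary_mat n M \<longleftrightarrow>
     M \<in> carrier_mat n n \<and> mat_adjoint M * M = 1\<^sub>m n \<and> M * mat_adjoint M = 1\<^sub>m n"

text \<open>Only the values of \<open>\<Psi>\<close> on the unit disc matter. The matrix \<open>I - zD\<close> is invertible there
  because \<open>D\<close> is a contraction, so \<open>mat_inverse\<close> does return a value. The case \<open>s = 0\<close> (a constant
  unitary matrix) is allowed.\<close>

definition rational_inner :: "nat \<Rightarrow> (complex \<Rightarrow> complex mat) \<Rightarrow> bool" where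
  "rational_inner r \<Psi> \<longleftrightarrow>
     (\<exists>s A B C D.
        A \<in> carrier_mat r r \<and> B \<in> carrier_mat r s \<and> C \<in> carrier_mat s r \<and> D \<in> carrier_mat s s \<and>
        unitary_mat (r + s) (four_block_mat A B C D) \<and>
        (\<forall>z\<in>disc. \<Psi> z = A + z \<cdot>\<^sub>m (B * the (mat_inverse (1\<^sub>m s - z \<cdot>\<^sub>m D)) * C)))"

abbreviation eval_mat :: "complex poly mat \<Rightarrow> complex \<Rightarrow> complex mat" where
  "eval_mat F z \<equiv> map_mat (\<lambda>p. poly p z) F"

text \<open>\<open>\<Psi> = F / q\<close> in lowest terms. The identity is written without division. That \<open>q\<close> has no zeros
  in the disc is then automatic: at such a zero \<open>a\<close> all entries of \<open>F\<close> would vanish, so that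
  \<open>[:- a, 1:]\<close> would be a common factor.\<close>

definition reduced_fraction ::
    "nat \<Rightarrow> (complex \<Rightarrow> complex mat) \<Rightarrow> complex poly mat \<Rightarrow> complex poly \<Rightarrow> bool" where
  "reduced_fraction r \<Psi> F q \<longleftrightarrow>
     F \<in> carrier_mat r r \<and> q \<noteq> 0 \<and>
     (\<forall>z\<in>disc. poly q z \<cdot>\<^sub>m \<Psi> z = eval_mat F z) \<and>
     (\<forall>d. d dvd q \<and> (\<forall>i<r. \<forall>j<r. d dvd F $$ (i, j)) \<longrightarrow> degree d = 0)"

text \<open>The pair \<open>(F, q)\<close> is determined by \<open>\<Psi>\<close> up to a common nonzero constant, which does not affect
  the equation, so the quantifier merely names the representation.\<close>

definition variety_of_inner ::
    "nat \<Rightarrow> (complex \<Rightarrow> complex mat) \<Rightarrow> (complex \<times> complex) set" where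
  "variety_of_inner r \<Psi> =
     {(z1, z2). \<exists>F q. reduced_fraction r \<Psi> F q \<and>
        det (eval_mat F z1 - (z2 * poly q z1) \<cdot>\<^sub>m 1\<^sub>m r) = 0}"


section \<open>Finite model triples\<close>

text \<open>The inner product is linear in the first and conjugate-linear in the second argument.
  Completeness is automatic in finite dimension.\<close>

locale fd_hilbert_space = vector_space scale
  for scale :: "complex \<Rightarrow> 'a::ab_group_add \<Rightarrow> 'a" +
  fixes ip :: "'a \<Rightarrow> 'a \<Rightarrow> complex"
  assumes finite_dim: "\<exists>B. finite B \<and> span B = UNIV"
    and ip_add_left: "ip (x + y) w = ip x w + ip y w"
    and ip_scale_left: "ip (scale c x) y = c * ip x y"
    and ip_cnj: "ip y x = cnj (ip x y)"
    and ip_pos: "x \<noteq> 0 \<Longrightarrow> 0 < Re (ip x x)"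
begin

definition adj :: "('a \<Rightarrow> 'a) \<Rightarrow> 'a \<Rightarrow> 'a" where
  "adj A = (THE B. \<forall>x y. ip (A x) y = ip x (B y))"

definition orthogonal_projection :: "('a \<Rightarrow> 'a) \<Rightarrow> bool" where
  "orthogonal_projection P \<longleftrightarrow>
     Vector_Spaces.linear scale scale P \<and> (\<forall>x. P (P x) = P x) \<and> (\<forall>x y. ip (P x) y = ip x (P y))"

definition unitary_op :: "('a \<Rightarrow> 'a) \<Rightarrow> bool" where
  "unitary_op U \<longleftrightarrow>
     Vector_Spaces.linear scale scale U \<and> surj U \<and> (\<forall>x y. ip (U x) (U y) = ip x y)"

definition joint_spectrum :: "('a \<Rightarrow> 'a) \<Rightarrow> ('a \<Rightarrow> 'a) \<Rightarrow> (complex \<times> complex) set" where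
  "joint_spectrum S T = {(a, b). \<exists>v. v \<noteq> 0 \<and> S v = scale a v \<and> T v = scale b v}"

definition perp :: "('a \<Rightarrow> 'a) \<Rightarrow> 'a \<Rightarrow> 'a" where
  "perp P x = x - P x"

definition model_variety :: "('a \<Rightarrow> 'a) \<Rightarrow> ('a \<Rightarrow> 'a) \<Rightarrow> (complex \<times> complex) set" where
  "model_variety P U =
     {(z1, z2). (z1, z2) \<in> joint_spectrum
        (\<lambda>x. perp P (U x) + scale (z1 * z2) (P (U x)))
        (\<lambda>x. adj U (P x) + scale (z1 * z2) (adj U (perp P x)))}"

text \<open>The operator \<open>P (I - z U\<^sup>* P\<^sup>\<bottom>)\<^sup>-\<^sup>1 U\<^sup>* P\<close> on the whole space; it maps \<open>range P\<close> into
  itself. For \<open>z\<close> in the disc the map being inverted is a bijection.\<close>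

definition char_fun :: "('a \<Rightarrow> 'a) \<Rightarrow> ('a \<Rightarrow> 'a) \<Rightarrow> complex \<Rightarrow> 'a \<Rightarrow> 'a" where
  "char_fun P U z x = P (inv_into UNIV (\<lambda>y. y - scale z (adj U (perp P y))) (adj U (P x)))"

definition orthonormal_basis :: "'a list \<Rightarrow> 'a set \<Rightarrow> bool" where
  "orthonormal_basis es S \<longleftrightarrow>
     (\<forall>i<length es. \<forall>j<length es. ip (es ! i) (es ! j) = (if i = j then 1 else 0)) \<and>
     span (set es) = S"

definition matrix_of :: "'a list \<Rightarrow> ('a \<Rightarrow> 'a) \<Rightarrow> complex mat" where
  "matrix_of es A = mat (length es) (length es) (\<lambda>(i, j). ip (A (es ! j)) (es ! i))"

text \<open>\<open>\<Psi>\<^bsub>P,U\<^esub>\<close> as a matrix-valued function: the operator on \<open>range P\<close>, written in an orthonormal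
  basis \<open>es\<close> of \<open>range P\<close>.\<close>

definition char_mat :: "'a list \<Rightarrow> ('a \<Rightarrow> 'a) \<Rightarrow> ('a \<Rightarrow> 'a) \<Rightarrow> complex \<Rightarrow> complex mat" where
  "char_mat es P U z = matrix_of es (char_fun P U z)"

end

definition finite_model_triple ::
    "(complex \<Rightarrow> 'a::ab_group_add \<Rightarrow> 'a) \<Rightarrow> ('a \<Rightarrow> 'a \<Rightarrow> complex) \<Rightarrow> ('a \<Rightarrow> 'a) \<Rightarrow> ('a \<Rightarrow> 'a) \<Rightarrow> bool" where
  "finite_model_triple sc ip P U \<longleftrightarrow>
     fd_hilbert_space sc ip \<and>
     fd_hilbert_space.orthogonal_projection sc ip P \<and>
     fd_hilbert_space.unitary_op sc ip U"

end

theory Submission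
  imports Defs
begin

text \<open>For \<open>z\<^sub>1\<close> in the disc, \<open>v\<close> is a joint eigenvector of the model pair at \<open>(z\<^sub>1, z\<^sub>2)\<close> iff
  \<open>P\<^sup>\<bottom> U v = z\<^sub>1 P\<^sup>\<bottom> v\<close> and \<open>P v = z\<^sub>2 P U v\<close>. With \<open>x = P U v\<close> the first equation says
  \<open>v = (I - z\<^sub>1 U\<^sup>* P\<^sup>\<bottom>)\<^sup>-\<^sup>1 U\<^sup>* x\<close>, and then the second one says \<open>\<Psi>(z\<^sub>1) x = z\<^sub>2 x\<close>; moreover \<open>x = 0\<close> would give
  \<open>U v = z\<^sub>1 P\<^sup>\<bottom> v\<close>, hence \<open>v = 0\<close>. The variety of \<open>\<Psi>\<close> is defined
  through a reduced fraction; one exists by Cramer's rule, with \<open>det (I - z U\<^sup>* P\<^sup>\<bottom>)\<close> as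
  denominator.\<close>

section \<open>Matrices of rational functions\<close>

lemma range_poly_const: "(\<lambda>_. c) \<in> range (poly :: complex poly \<Rightarrow> _)"
proof -
  have "(\<lambda>_. c) = poly [:c:]" by auto
  then show ?thesis by blast
qed

lemma range_poly_id: "(\<lambda>z. z) \<in> range (poly :: complex poly \<Rightarrow> _)"
proof -
  have "(\<lambda>z. z) = poly [:0, 1::complex:]" by auto
  then show ?thesis by blast
qed

lemma range_poly_add:
  fixes f g :: "complex \<Rightarrow> complex"
  assumes "f \<in> range poly" "g \<in> range poly"
  shows "(\<lambda>z. f z + g z) \<in> range poly"
proof -
  from assms obtain p q where "f = poly p" "g = poly q" by auto
  then have "(\<lambda>z. f z + g z) = poly (p + q)" by auto
  then show ?thesis by blast
qed

lemma range_poly_mult: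
  fixes f g :: "complex \<Rightarrow> complex"
  assumes "f \<in> range poly" "g \<in> range poly"
  shows "(\<lambda>z. f z * g z) \<in> range poly"
proof -
  from assms obtain p q where "f = poly p" "g = poly q" by auto
  then have "(\<lambda>z. f z * g z) = poly (p * q)" by auto
  then show ?thesis by blast
qed

lemma range_poly_sum:
  fixes f :: "'i \<Rightarrow> complex \<Rightarrow> complex"
  assumes "\<And>i. i \<in> I \<Longrightarrow> f i \<in> range poly"
  shows "(\<lambda>z. \<Sum>i\<in>I. f i z) \<in> range poly"
  using assms
  by (induction I rule: infinite_finite_induct)
    (auto intro!: range_poly_const range_poly_add)

lemma range_poly_prod:
  fixes f :: "'i \<Rightarrow> complex \<Rightarrow> complex"
  assumes "\<And>i. i \<in> I \<Longrightarrow> f i \<in> range poly"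
  shows "(\<lambda>z. \<Prod>i\<in>I. f i z) \<in> range poly"
  using assms
  by (induction I rule: infinite_finite_induct)
    (auto intro!: range_poly_const range_poly_mult)

lemma range_poly_det:
  fixes M :: "complex \<Rightarrow> complex mat"
  assumes "\<And>z. M z \<in> carrier_mat n n"
    and "\<And>i j. i < n \<Longrightarrow> j < n \<Longrightarrow> (\<lambda>z. M z $$ (i, j)) \<in> range poly"
  shows "(\<lambda>z. det (M z)) \<in> range poly"
  unfolding det_def'[OF assms(1)]
  by (intro range_poly_sum range_poly_mult range_poly_const range_poly_prod assms(2))
     (auto simp: permutes_in_image)

section \<open>Reduced fractions and the varieties they define\<close>

lemma reduced_fraction_denominator_nonzero:
  assumes "reduced_fraction r \<Psi> F q" "a \<in> disc"
  shows "poly q a \<noteq> 0"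
proof
  assume q: "poly q a = 0"
  have F: "F \<in> carrier_mat r r" and eq: "poly q a \<cdot>\<^sub>m \<Psi> a = eval_mat F a"
    and red: "\<And>d. d dvd q \<Longrightarrow> (\<And>i j. i < r \<Longrightarrow> j < r \<Longrightarrow> d dvd F $$ (i, j)) \<Longrightarrow> degree d = 0"
    using assms unfolding reduced_fraction_def by auto
  have "[:- a, 1:] dvd F $$ (i, j)" if "i < r" "j < r" for i j
  unfolding poly_eq_0_iff_dvd[symmetric]
  proof -
    \<comment> \<open>The size of \<open>\<Psi> a\<close> is recovered from \<open>eq\<close>,
      because scalar multiplication preserves dimensions.\<close>
    have dim: "dim_row (\<Psi> a) = r" "dim_col (\<Psi> a) = r"
      using arg_cong[OF eq, of dim_row] arg_cong[OF eq, of dim_col] F by auto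
    have "poly (F $$ (i, j)) a = eval_mat F a $$ (i, j)" using F that by auto
    also have "\<dots> = poly q a * \<Psi> a $$ (i, j)" unfolding eq[symmetric] using dim that by auto
    finally show "poly (F $$ (i, j)) a = 0" using q by simp
  qed
  then have "degree [:- a, 1:] = 0" using red q unfolding poly_eq_0_iff_dvd by blast
  then show False by simp
qed

text \<open>Cancelling a nonconstant common factor lowers the degree of \<open>q\<close>, so the
  process stops. Every factor of \<open>q\<close> is again free of zeros in the disc, which allows
  the cancellation in the values as well.\<close>

lemma reduced_fraction_exists:
  assumes "F \<in> carrier_mat r r" "\<And>z. z \<in> disc \<Longrightarrow> \<Psi> z \<in> carrier_mat r r"
    and "\<And>z. z \<in> disc \<Longrightarrow> poly q z \<noteq> 0"
    and "\<And>z. z \<in> disc \<Longrightarrow> poly q z \<cdot>\<^sub>m \<Psi> z = eval_mat F z"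
  shows "\<exists>F q. reduced_fraction r \<Psi> F q"
  using assms
proof (induction "degree q" arbitrary: F q rule: less_induct)
  case less
  have "poly q 0 \<noteq> 0" using less.prems(3) by simp
  then have q0: "q \<noteq> 0" by auto
  show ?case
  proof (cases "\<exists>d. d dvd q \<and> (\<forall>i<r. \<forall>j<r. d dvd F $$ (i, j)) \<and> degree d \<noteq> 0")
    case False
    then have "reduced_fraction r \<Psi> F q"
      using less.prems q0 unfolding reduced_fraction_def by auto
    then show ?thesis by blast
  next
    case True
    then obtain d where d: "d dvd q" "\<forall>i<r. \<forall>j<r. d dvd F $$ (i, j)" "degree d \<noteq> 0" by blast
    from d(1) obtain q' where q': "q = d * q'" by blast
    define F' where "F' = mat r r (\<lambda>ij. F $$ ij div d)"
    have deg: "degree q' < degree q" using q' q0 d(3) by (simp add: degree_mult_eq)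
    have nz: "poly d z \<noteq> 0" "poly q' z \<noteq> 0" if "z \<in> disc" for z
      using less.prems(3)[OF that] q' by auto
    have "poly q' z \<cdot>\<^sub>m \<Psi> z = eval_mat F' z" if z: "z \<in> disc" for z
    proof (rule eq_matI)
      fix i j assume "i < dim_row (eval_mat F' z)" "j < dim_col (eval_mat F' z)"
      then have ij: "i < r" "j < r" by (auto simp: F'_def)
      have c: "\<Psi> z \<in> carrier_mat r r" using less.prems(2) z .
      have "F $$ (i, j) = d * F' $$ (i, j)" using ij d(2) by (simp add: F'_def)
      then have "poly d z * poly (F' $$ (i, j)) z = eval_mat F z $$ (i, j)"
        using ij less.prems(1) by simp
      also have "\<dots> = poly q z * \<Psi> z $$ (i, j)"
        unfolding less.prems(4)[OF z, symmetric] using ij c by simp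
      finally show "(poly q' z \<cdot>\<^sub>m \<Psi> z) $$ (i, j) = eval_mat F' z $$ (i, j)"
        using nz(1)[OF z] q' ij c by (simp add: F'_def)
    qed (use less.prems(2)[OF z] in \<open>auto simp: F'_def\<close>)
    then show ?thesis
      using less.hyps[OF deg, of F'] less.prems(2) nz by (auto simp: F'_def)
  qed
qed

text \<open>On the disc the matrix in the definition is
  \<open>\<Psi> z1 - z2 \<cdot>\<^sub>m 1\<^sub>m r\<close> times the nonzero number
  \<open>poly q z1\<close>, so every reduced fraction gives the same condition. Existence is assumed
  because \<open>variety_of_inner\<close> would be empty otherwise.\<close>

lemma variety_of_inner_iff:
  assumes "\<exists>F q. reduced_fraction r \<Psi> F q" "z1 \<in> disc" "\<Psi> z1 \<in> carrier_mat r r"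
  shows "(z1, z2) \<in> variety_of_inner r \<Psi> \<longleftrightarrow> det (\<Psi> z1 - z2 \<cdot>\<^sub>m 1\<^sub>m r) = 0"
proof -
  have "det (eval_mat F z1 - (z2 * poly q z1) \<cdot>\<^sub>m 1\<^sub>m r) = 0 \<longleftrightarrow> det (\<Psi> z1 - z2 \<cdot>\<^sub>m 1\<^sub>m r) = 0"
    if red: "reduced_fraction r \<Psi> F q" for F q
  proof -
    have "eval_mat F z1 = poly q z1 \<cdot>\<^sub>m \<Psi> z1"
      using red assms(2) unfolding reduced_fraction_def by auto
    then have "eval_mat F z1 - (z2 * poly q z1) \<cdot>\<^sub>m 1\<^sub>m r = poly q z1 \<cdot>\<^sub>m (\<Psi> z1 - z2 \<cdot>\<^sub>m 1\<^sub>m r)"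
      using assms(3) by (auto intro!: eq_matI simp: algebra_simps)
    then show ?thesis
      using reduced_fraction_denominator_nonzero[OF red assms(2)] by simp
  qed
  then show ?thesis using assms(1) unfolding variety_of_inner_def by auto
qed

text \<open>Reduced fractions are constrained only by the values of the function on the disc, hence
  so is the whole variety.\<close>

lemma variety_of_inner_cong:
  assumes "\<And>z. z \<in> disc \<Longrightarrow> \<Psi> z = \<Phi> z"
  shows "variety_of_inner r \<Psi> = variety_of_inner r \<Phi>"
proof -
  have "reduced_fraction r \<Psi> F q \<longleftrightarrow> reduced_fraction r \<Phi> F q" for F q
    using assms unfolding reduced_fraction_def by auto
  then show ?thesis unfolding variety_of_inner_def by simp
qed

section \<open>Finite-dimensional Hilbert spaces\<close>

context fd_hilbert_space
begin

section \<open>Linear maps, the inner product, and bijectivity in finite dimension\<close>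

abbreviation lin :: "('a \<Rightarrow> 'a) \<Rightarrow> bool" where
  "lin \<equiv> Vector_Spaces.linear scale scale"

lemma lin_iff: "lin A \<longleftrightarrow> (\<forall>x y. A (x + y) = A x + A y) \<and> (\<forall>c x. A (scale c x) = scale c (A x))"
  unfolding Vector_Spaces.linear_iff using vector_space_axioms by auto

lemma lin_sum: "lin A \<Longrightarrow> A (\<Sum>i\<in>I. f i) = (\<Sum>i\<in>I. A (f i))"
  unfolding module_hom_iff_linear[symmetric] by (rule module_hom.sum)

lemma lin_0: "lin A \<Longrightarrow> A 0 = 0"
  unfolding module_hom_iff_linear[symmetric] by (rule module_hom.zero)

lemma lin_diff: "lin A \<Longrightarrow> A (x - y) = A x - A y"
  unfolding module_hom_iff_linear[symmetric] by (rule module_hom.diff)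

lemma ip_0_left [simp]: "ip 0 y = 0"
  using ip_add_left[of 0 0 y] by simp

lemma ip_0_right [simp]: "ip y 0 = 0"
  using ip_cnj[of 0 y] by simp

lemma ip_minus_left: "ip (- x) y = - ip x y"
  using ip_add_left[of x "- x" y] by (simp add: eq_neg_iff_add_eq_0 add.commute)

lemma ip_diff_left: "ip (x - y) w = ip x w - ip y w"
  using ip_add_left[of x "- y" w] ip_minus_left[of y w] by simp

lemma ip_diff_right: "ip w (x - y) = ip w x - ip w y"
  by (metis complex_cnj_diff ip_diff_left ip_cnj)

lemma ip_scale_right: "ip x (scale c y) = cnj c * ip x y"
  by (metis complex_cnj_mult ip_scale_left ip_cnj)

lemma ip_sum_left: "ip (\<Sum>i\<in>I. f i) y = (\<Sum>i\<in>I. ip (f i) y)"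
  by (induction I rule: infinite_finite_induct) (auto simp: ip_add_left)

lemma ip_self: "ip x x = of_real (Re (ip x x))"
  using ip_cnj[of x x] by (metis Reals_cnj_iff of_real_Re)

lemma ip_self_nonneg: "0 \<le> Re (ip x x)"
  using ip_pos[of x] by (cases "x = 0") auto

lemma ip_self_eq_0: "ip x x = 0 \<longleftrightarrow> x = 0"
  using ip_pos[of x] by force

lemma ip_eqI: "(\<And>x. ip x y = ip x w) \<Longrightarrow> y = w"
  using ip_self_eq_0[of "y - w"] by (simp add: ip_diff_right)

text \<open>A maximal independent subset of a finite spanning set is a finite basis; this gives
  access to the theory of finite-dimensional spaces.\<close>

lemma finite_dimensional: "\<exists>B. finite_dimensional_vector_space scale B"
proof -
  obtain B where B: "finite B" "span B = UNIV" using finite_dim by blast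
  obtain C where C: "C \<subseteq> B" "independent C" "B \<subseteq> span C" using maximal_independent_subset by blast
  have "span C = UNIV" using B(2) C(3) span_mono span_span by (metis top.extremum_uniqueI)
  then have "finite_dimensional_vector_space scale C"
    using C B(1) finite_subset by unfold_locales auto
  then show ?thesis by blast
qed

text \<open>A trivial kernel gives injectivity, and injective endomorphisms in finite dimension are
  surjective.\<close>

lemma bij_if_lin_kernel_trivial:
  assumes "lin A" "\<And>x. A x = 0 \<Longrightarrow> x = 0"
  shows "bij A"
proof -
  obtain B where "finite_dimensional_vector_space scale B" using finite_dimensional by blast
  then interpret finite_dimensional_vector_space scale B .
  have "inj A" using assms by (metis (no_types) injI lin_diff eq_iff_diff_eq_0)
  with linear_inj_imp_surj[OF assms(1)] show ?thesis by (simp add: bij_def)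
qed

section \<open>Coordinates and matrices with respect to an orthonormal basis\<close>

definition coords :: "'a list \<Rightarrow> 'a \<Rightarrow> complex vec" where
  "coords es x = vec (length es) (\<lambda>i. ip x (es ! i))"

lemma dim_coords [simp]: "dim_vec (coords es x) = length es"
  by (simp add: coords_def)

lemma coords_carrier [simp]: "coords es x \<in> carrier_vec (length es)"
  by (simp add: coords_def)

lemma matrix_of_carrier [simp]: "matrix_of es A \<in> carrier_mat (length es) (length es)"
  by (simp add: matrix_of_def)

lemma coords_of_combination:
  assumes "orthonormal_basis es S" "i < length es"
  shows "ip (\<Sum>j<length es. scale (c j) (es ! j)) (es ! i) = c i"
proof -
  have "ip (\<Sum>j<length es. scale (c j) (es ! j)) (es ! i) = (\<Sum>j<length es. c j * (if j = i then 1 else 0))"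
    using assms by (auto simp: ip_sum_left ip_scale_left orthonormal_basis_def intro!: sum.cong)
  also have "\<dots> = c i" using assms(2) by (simp add: sum.delta if_distrib cong: if_cong)
  finally show ?thesis .
qed

lemma combination_in_span: "(\<Sum>j<length es. scale (c j) (es ! j)) \<in> span (set es)"
  by (intro span_sum span_scale span_base) auto

lemma orthonormal_expansion:
  assumes "orthonormal_basis es S" "x \<in> S"
  shows "x = (\<Sum>i<length es. scale (ip x (es ! i)) (es ! i))"
proof -
  have "x \<in> span (set es)" using assms unfolding orthonormal_basis_def by simp
  then show ?thesis
  proof (induction rule: span_induct_alt)
    case base
    then show ?case by simp
  next
    case (step c a y)
    then obtain k where k: "k < length es" "a = es ! k" by (auto simp: in_set_conv_nth)
    have "(\<Sum>i<length es. scale (ip a (es ! i)) (es ! i))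
        = (\<Sum>i<length es. if i = k then es ! i else 0)"
    proof (rule sum.cong)
      fix i assume "i \<in> {..<length es}"
      then have "ip a (es ! i) = (if i = k then 1 else 0)"
        using assms(1) k unfolding orthonormal_basis_def by auto
      then show "scale (ip a (es ! i)) (es ! i) = (if i = k then es ! i else 0)" by simp
    qed simp
    also have "\<dots> = a" using k by simp
    finally have a: "(\<Sum>i<length es. scale (ip a (es ! i)) (es ! i)) = a" .
    have "(\<Sum>i<length es. scale (ip (scale c a + y) (es ! i)) (es ! i))
        = scale c (\<Sum>i<length es. scale (ip a (es ! i)) (es ! i))
          + (\<Sum>i<length es. scale (ip y (es ! i)) (es ! i))"
      by (simp add: ip_add_left ip_scale_left scale_left_distrib sum.distrib scale_sum_right)
    then show ?case using a step(2) by simp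
  qed
qed

lemma matrix_of_mult_coords:
  assumes "orthonormal_basis es S" "x \<in> S" "lin A"
  shows "matrix_of es A *\<^sub>v coords es x = coords es (A x)"
proof (rule eq_vecI)
  fix i assume "i < dim_vec (coords es (A x))"
  then have i: "i < length es" by simp
  have "A x = (\<Sum>j<length es. scale (ip x (es ! j)) (A (es ! j)))"
    using arg_cong[OF orthonormal_expansion[OF assms(1,2)], of A] assms(3)
    by (simp add: lin_sum lin_iff)
  then have "ip (A x) (es ! i) = (\<Sum>j<length es. ip x (es ! j) * ip (A (es ! j)) (es ! i))"
    by (simp add: ip_sum_left ip_scale_left)
  then show "(matrix_of es A *\<^sub>v coords es x) $ i = coords es (A x) $ i"
    using i by (simp add: matrix_of_def coords_def scalar_prod_def mult.commute lessThan_atLeast0)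
qed (simp add: matrix_of_def)

lemma coords_eq_0_iff:
  assumes "orthonormal_basis es S" "x \<in> S"
  shows "coords es x = 0\<^sub>v (length es) \<longleftrightarrow> x = 0"
proof
  assume h: "coords es x = 0\<^sub>v (length es)"
  have "ip x (es ! i) = 0" if "i < length es" for i
    using arg_cong[OF h, of "\<lambda>v. v $ i"] that by (simp add: coords_def)
  then show "x = 0" by (subst orthonormal_expansion[OF assms]) simp
qed (auto simp: coords_def)

text \<open>Taking coordinates is a bijection from \<open>S\<close> onto complex vectors that turns
  \<open>A\<close> into its matrix, so null vectors correspond. It is applied to the pencil with
  \<open>S = UNIV\<close>, and to \<open>\<Psi>(z1) - z2\<close> with
  \<open>S = range P\<close>.\<close>

lemma det_matrix_of_eq_0_iff:
  assumes es: "orthonormal_basis es S" and A: "lin A" "\<And>x. x \<in> S \<Longrightarrow> A x \<in> S"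
  shows "det (matrix_of es A) = 0 \<longleftrightarrow> (\<exists>x\<in>S. x \<noteq> 0 \<and> A x = 0)"
  unfolding det_0_iff_vec_prod_zero[OF matrix_of_carrier]
proof
  assume "\<exists>v. v \<in> carrier_vec (length es) \<and> v \<noteq> 0\<^sub>v (length es)
      \<and> matrix_of es A *\<^sub>v v = 0\<^sub>v (length es)"
  then obtain v where v: "v \<in> carrier_vec (length es)" "v \<noteq> 0\<^sub>v (length es)"
    "matrix_of es A *\<^sub>v v = 0\<^sub>v (length es)" by blast
  define x where "x = (\<Sum>j<length es. scale (v $ j) (es ! j))"
  have x: "x \<in> S" using combination_in_span es unfolding x_def orthonormal_basis_def by auto
  have cx: "coords es x = v"
    using v(1) coords_of_combination[OF es] by (auto simp: coords_def x_def)
  have "coords es (A x) = 0\<^sub>v (length es)"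
    using matrix_of_mult_coords[OF es x A(1)] v(3) cx by simp
  \<comment> \<open>Invariance puts \<open>A x\<close> into \<open>S\<close>, where vanishing
    coordinates force a vector to vanish.\<close>
  then have "A x = 0" using coords_eq_0_iff[OF es A(2)[OF x]] by simp
  moreover have "x \<noteq> 0" using coords_eq_0_iff[OF es x] cx v(2) by simp
  ultimately show "\<exists>x\<in>S. x \<noteq> 0 \<and> A x = 0" using x by blast
next
  assume "\<exists>x\<in>S. x \<noteq> 0 \<and> A x = 0"
  then obtain x where x: "x \<in> S" "x \<noteq> 0" "A x = 0" by blast
  have "coords es (0::'a) = 0\<^sub>v (length es)" by (auto simp: coords_def)
  then show "\<exists>v. v \<in> carrier_vec (length es) \<and> v \<noteq> 0\<^sub>v (length es)
      \<and> matrix_of es A *\<^sub>v v = 0\<^sub>v (length es)"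
    using x matrix_of_mult_coords[OF es x(1) A(1)] coords_eq_0_iff[OF es x(1)]
    by (intro exI[of _ "coords es x"]) simp
qed

lemma matrix_of_diff_scale:
  assumes "orthonormal_basis es S"
  shows "matrix_of es (\<lambda>x. A x - scale c x) = matrix_of es A - c \<cdot>\<^sub>m 1\<^sub>m (length es)"
  using assms
  by (intro eq_matI) (auto simp: matrix_of_def ip_diff_left ip_scale_left orthonormal_basis_def)

text \<open>Gram-Schmidt: a new vector already in the span is dropped; otherwise its component
  orthogonal to the span is normalised and appended.\<close>

lemma orthonormal_basis_of_finite_span:
  assumes "finite B"
  shows "\<exists>es. orthonormal_basis es (span B)"
  using assms
proof (induction B)
  case empty
  then show ?case by (intro exI[of _ "[]"]) (auto simp: orthonormal_basis_def)
next
  case (insert b B)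
  then obtain es where es: "orthonormal_basis es (span B)" by blast
  show ?case
  proof (cases "b \<in> span B")
    case True
    then show ?thesis using es by (metis span_redundant)
  next
    case False
    \<comment> \<open>\<open>p\<close> is the orthogonal projection of \<open>b\<close> onto
      \<open>span B\<close>, and \<open>u\<close> is the remainder.\<close>
    define p where "p = (\<Sum>j<length es. scale (ip b (es ! j)) (es ! j))"
    define u where "u = b - p"
    have sp: "span (set es) = span B" using es by (simp add: orthonormal_basis_def)
    have p: "p \<in> span B" unfolding p_def sp[symmetric] by (rule combination_in_span)
    have u0: "u \<noteq> 0" using False p unfolding u_def by auto
    have orth: "ip u (es ! i) = 0" if "i < length es" for i
      using coords_of_combination[OF es that] unfolding u_def p_def by (simp add: ip_diff_left)
    \<comment> \<open>\<open>t\<close> is the reciprocal of the norm of \<open>u\<close>, and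
      \<open>c\<close> the same number as a complex scalar.\<close>
    define t where "t = 1 / sqrt (Re (ip u u))"
    define c where "c = complex_of_real t"
    define e where "e = scale c u"
    have c0: "c \<noteq> 0" using ip_pos[OF u0] by (simp add: c_def t_def)
    have "ip e e = c * cnj c * ip u u" by (simp add: e_def ip_scale_left ip_scale_right)
    also have "\<dots> = of_real (t\<^sup>2 * Re (ip u u))"
      by (subst ip_self) (simp add: c_def power2_eq_square)
    also have "\<dots> = 1" using ip_pos[OF u0] by (simp add: t_def power_divide)
    finally have ee: "ip e e = 1" .
    have e1: "ip e (es ! i) = 0" "ip (es ! i) e = 0" if "i < length es" for i
      using orth[OF that] ip_cnj[of "es ! i" u] by (auto simp: e_def ip_scale_left ip_scale_right)
    have "span (set (es @ [e])) = span (insert b B)"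
    unfolding span_eq
    proof
      show "set (es @ [e]) \<subseteq> span (insert b B)"
      proof -
        have "set es \<subseteq> span (insert b B)"
          using sp span_superset[of "set es"] span_mono[of B "insert b B"] by auto
        moreover have "e \<in> span (insert b B)"
          unfolding e_def u_def using p span_mono[of B "insert b B"]
          by (intro span_scale span_diff) (auto intro: span_base)
        ultimately show ?thesis by simp
      qed
      show "insert b B \<subseteq> span (set (es @ [e]))"
      proof -
        have B: "span B \<subseteq> span (set (es @ [e]))" using sp span_mono[of "set es" "set (es @ [e])"] by auto
        have "b = scale (1 / c) e + p" using c0 by (simp add: e_def u_def)
        also have "\<dots> \<in> span (set (es @ [e]))"
          using B p by (intro span_add span_scale) (auto intro: span_base)
        finally show ?thesis using B span_superset[of B] by auto
      qed
    qed
    then have "orthonormal_basis (es @ [e]) (span (insert b B))"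
      using es ee e1 unfolding orthonormal_basis_def
      by (auto simp: nth_append less_Suc_eq)
    then show ?thesis by blast
  qed
qed

lemma orthonormal_basis_UNIV: "\<exists>es. orthonormal_basis es UNIV"
  using finite_dim orthonormal_basis_of_finite_span by metis

end

section \<open>Model triples\<close>

locale model_triple = fd_hilbert_space scale ip
  for scale :: "complex \<Rightarrow> 'a::ab_group_add \<Rightarrow> 'a" and ip +
  fixes P U :: "'a \<Rightarrow> 'a"
  assumes proj: "orthogonal_projection P" and unitary: "unitary_op U"
begin

section \<open>The adjoint of \<open>U\<close> and the splitting of vectors by
  \<open>P\<close>\<close>

lemma lin_P: "lin P" and P_P [simp]: "P (P x) = P x" and ip_P: "ip (P x) y = ip x (P y)"
  using proj unfolding orthogonal_projection_def by auto

lemma lin_U: "lin U" and surj_U: "surj U" and ip_U: "ip (U x) (U y) = ip x y"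
  using unitary unfolding unitary_op_def by auto

lemma bij_U: "bij U"
  using bij_if_lin_kernel_trivial[OF lin_U] ip_U ip_self_eq_0 by (metis lin_0 lin_U)

text \<open>The inverse has the defining property of the adjoint because \<open>U\<close> is a
  surjective isometry; nondegeneracy of the inner product makes it the only such map, which settles
  the definite description.\<close>

lemma adj_U: "adj U = inv_into UNIV U"
  unfolding adj_def
proof (rule the_equality)
  show *: "\<forall>x y. ip (U x) y = ip x (inv_into UNIV U y)"
    using ip_U by (metis surj_U surj_f_inv_f)
  fix B assume "\<forall>x y. ip (U x) y = ip x (B y)"
  with * show "B = inv_into UNIV U" by (intro ext ip_eqI) metis
qed

lemma adj_U_U [simp]: "adj U (U x) = x" and U_adj_U [simp]: "U (adj U x) = x"
  using bij_U by (simp_all add: adj_U bij_is_inj surj_U surj_f_inv_f)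

lemma adj_U_eq_iff: "adj U x = y \<longleftrightarrow> x = U y"
  by auto

lemma lin_adj_U: "lin (adj U)"
  using lin_U unfolding lin_iff adj_U_eq_iff by simp

lemma lin_perp: "lin (perp P)"
  using lin_P unfolding lin_iff perp_def by (simp add: scale_right_diff_distrib)

lemma P_perp [simp]: "P (perp P x) = 0" and perp_P [simp]: "perp P (P x) = 0"
  and perp_perp [simp]: "perp P (perp P x) = perp P x"
  by (simp_all add: perp_def lin_diff[OF lin_P])

text \<open>Used to split an equation between vectors into its components in \<open>range P\<close>
  and in the orthogonal complement.\<close>

lemma eq_iff_P_perp: "x = y \<longleftrightarrow> P x = P y \<and> perp P x = perp P y"
  by (auto simp: perp_def)

section \<open>The resolvent equation and the values of \<open>char_fun\<close>\<close>

lemma norm_perp_le: "Re (ip (perp P x) (perp P x)) \<le> Re (ip x x)"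
proof -
  have "ip (perp P x) (perp P x) = ip x x - ip (P x) (P x)"
    by (simp add: perp_def ip_diff_left ip_diff_right ip_P)
  then show ?thesis using ip_self_nonneg[of "P x"] by simp
qed

text \<open>\<open>U\<close> preserves norms, \<open>perp P\<close> does not increase them, and
  multiplication by \<open>z\<close> strictly shrinks them, so a nonzero \<open>y\<close> would have
  norm smaller than itself.\<close>

lemma eq_scale_perp_imp_0:
  assumes "z \<in> disc" "U y = scale z (perp P y)"
  shows "y = 0"
proof (rule ccontr)
  assume "y \<noteq> 0"
  have "ip y y = of_real ((cmod z)\<^sup>2) * ip (perp P y) (perp P y)"
    unfolding ip_U[of y y, symmetric] assms(2)
    by (simp add: ip_scale_left ip_scale_right mult.assoc complex_norm_square[of z, simplified])
  then have "Re (ip y y) = (cmod z)\<^sup>2 * Re (ip (perp P y) (perp P y))" by simp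
  also have "\<dots> \<le> (cmod z)\<^sup>2 * Re (ip y y)" by (intro mult_left_mono norm_perp_le) simp
  also have "\<dots> < 1 * Re (ip y y)"
    using assms(1) ip_pos[OF \<open>y \<noteq> 0\<close>]
    by (intro mult_strict_right_mono) (auto simp: abs_square_less_1)
  finally show False by simp
qed

text \<open>The operator whose inverse occurs in \<open>char_fun\<close>.\<close>

definition pencil :: "complex \<Rightarrow> 'a \<Rightarrow> 'a" where
  "pencil z y = y - scale z (adj U (perp P y))"

lemma lin_pencil: "lin (pencil z)"
  using lin_adj_U lin_perp unfolding lin_iff pencil_def
  by (simp add: algebra_simps scale_right_diff_distrib scale_right_distrib scale_left_commute)

lemma U_pencil: "U (pencil z y) = U y - scale z (perp P y)"
  using lin_U by (simp add: pencil_def lin_diff lin_iff)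

text \<open>Applying \<open>U\<close> removes the adjoint from the equation to be solved.\<close>

lemma pencil_eq_adj_iff: "pencil z y = adj U x \<longleftrightarrow> U y - scale z (perp P y) = x"
  by (metis U_pencil adj_U_U U_adj_U)

lemma bij_pencil: "z \<in> disc \<Longrightarrow> bij (pencil z)"
proof (rule bij_if_lin_kernel_trivial[OF lin_pencil])
  fix y assume "z \<in> disc" "pencil z y = 0"
  then show "y = 0" using U_pencil[of z y] eq_scale_perp_imp_0[of z y] lin_0[OF lin_U] by simp
qed

lemma char_fun_eq: "char_fun P U z x = P (inv_into UNIV (pencil z) (adj U (P x)))"
  unfolding char_fun_def pencil_def ..

text \<open>Evaluates \<open>char_fun\<close> from any solution \<open>y\<close> of the resolvent
  equation, so that later arguments need not handle the inverse.\<close>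

lemma char_funI:
  assumes "z \<in> disc" "U y - scale z (perp P y) = P x"
  shows "char_fun P U z x = P y"
  using assms bij_pencil[of z] unfolding char_fun_eq
  by (metis bij_is_inj inv_f_f pencil_eq_adj_iff)

lemma resolvent_exists:
  assumes "z \<in> disc"
  obtains y where "U y - scale z (perp P y) = x"
  using bij_pencil[OF assms] by (metis bij_pointE pencil_eq_adj_iff)

text \<open>Solutions of the resolvent equation add and scale with the right-hand side, and
  \<open>char_funI\<close> carries this over to the values.\<close>

lemma lin_char_fun:
  assumes "z \<in> disc"
  shows "lin (char_fun P U z)"
  unfolding lin_iff
proof (intro conjI allI)
  fix x x'
  obtain y where y: "U y - scale z (perp P y) = P x" using resolvent_exists assms .
  obtain y' where y': "U y' - scale z (perp P y') = P x'" using resolvent_exists assms .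
  have "U (y + y') - scale z (perp P (y + y')) = P (x + x')"
    using lin_U lin_perp lin_P unfolding lin_iff
    by (simp add: scale_right_distrib add_diff_add y[symmetric] y'[symmetric])
  then show "char_fun P U z (x + x') = char_fun P U z x + char_fun P U z x'"
    using char_funI[OF assms] y y' lin_P unfolding lin_iff by simp
next
  fix c x
  obtain y where y: "U y - scale z (perp P y) = P x" using resolvent_exists assms .
  have "U (scale c y) - scale z (perp P (scale c y)) = P (scale c x)"
    using lin_U lin_perp lin_P unfolding lin_iff
    by (simp add: scale_right_diff_distrib scale_left_commute mult.commute flip: y)
  then show "char_fun P U z (scale c x) = scale c (char_fun P U z x)"
    using char_funI[OF assms] y lin_P unfolding lin_iff by simp
qed

section \<open>The model variety as an eigenvalue problem for \<open>\<Psi>\<close>\<close>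

lemma model_variety_iff:
  "(z1, z2) \<in> model_variety P U \<longleftrightarrow>
     (\<exists>v. v \<noteq> 0 \<and> perp P (U v) = scale z1 (perp P v) \<and> P v = scale z2 (P (U v)))"
proof -
  \<comment> \<open>Both eigenvalue equations are split by \<open>P\<close> and
    \<open>perp P\<close>, the second one after applying \<open>U\<close>. Of the four components
    two are \<open>?c\<close> and \<open>?d\<close>; the other two are \<open>z1\<close> times
    \<open>?d\<close> and \<open>z2\<close> times \<open>?c\<close>.\<close>
  have "perp P (U v) + scale (z1 * z2) (P (U v)) = scale z1 v
      \<and> adj U (P v) + scale (z1 * z2) (adj U (perp P v)) = scale z2 v
    \<longleftrightarrow> perp P (U v) = scale z1 (perp P v) \<and> P v = scale z2 (P (U v))" (is "?a \<and> ?b \<longleftrightarrow> ?c \<and> ?d") for v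
  proof -
    have "?a \<longleftrightarrow> scale (z1 * z2) (P (U v)) = scale z1 (P v) \<and> ?c"
      using lin_P lin_perp lin_0[OF lin_P] lin_0[OF lin_perp]
      by (subst eq_iff_P_perp) (simp add: lin_iff)
    moreover have "?b \<longleftrightarrow> P v + scale (z1 * z2) (perp P v) = scale z2 (U v)"
      using lin_adj_U lin_U unfolding lin_iff by (metis adj_U_eq_iff)
    moreover have "\<dots> \<longleftrightarrow> ?d \<and> scale (z1 * z2) (perp P v) = scale z2 (perp P (U v))"
      using lin_P lin_perp lin_0[OF lin_P] lin_0[OF lin_perp]
      by (subst eq_iff_P_perp) (simp add: lin_iff)
    moreover have "?c \<Longrightarrow> scale (z1 * z2) (perp P v) = scale z2 (perp P (U v))"
      by (simp add: mult.commute)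
    moreover have "?d \<Longrightarrow> scale (z1 * z2) (P (U v)) = scale z1 (P v)"
      by simp
    ultimately show ?thesis by argo
  qed
  then show ?thesis unfolding model_variety_def joint_spectrum_def by auto
qed

lemma model_variety_iff_char_fun:
  assumes "z1 \<in> disc"
  shows "(z1, z2) \<in> model_variety P U \<longleftrightarrow>
    (\<exists>x\<in>range P. x \<noteq> 0 \<and> char_fun P U z1 x - scale z2 x = 0)"
  unfolding model_variety_iff
proof
  assume "\<exists>v. v \<noteq> 0 \<and> perp P (U v) = scale z1 (perp P v) \<and> P v = scale z2 (P (U v))"
  then obtain v where v: "v \<noteq> 0" "perp P (U v) = scale z1 (perp P v)" "P v = scale z2 (P (U v))"
    by blast
  \<comment> \<open>\<open>P\<close> is doubled on the right to match the form of
    \<open>char_funI\<close>.\<close>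
  have eq: "U v - scale z1 (perp P v) = P (P (U v))" using v(2) by (simp add: perp_def algebra_simps)
  have "P (U v) \<noteq> 0" using eq_scale_perp_imp_0[OF assms, of v] v(1) eq by auto
  moreover have "char_fun P U z1 (P (U v)) - scale z2 (P (U v)) = 0"
    using char_funI[OF assms eq] v(3) by simp
  ultimately show "\<exists>x\<in>range P. x \<noteq> 0 \<and> char_fun P U z1 x - scale z2 x = 0" by blast
next
  assume "\<exists>x\<in>range P. x \<noteq> 0 \<and> char_fun P U z1 x - scale z2 x = 0"
  then obtain x where x: "P x = x" "x \<noteq> 0" "char_fun P U z1 x = scale z2 x"
    by (metis P_P eq_iff_diff_eq_0 imageE)
  \<comment> \<open>The resolvent solution \<open>y\<close> is the joint eigenvector; splitting
    \<open>U y\<close> by \<open>P\<close> and \<open>perp P\<close> gives both equations.\<close>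
  obtain y where y: "U y - scale z1 (perp P y) = P x" using resolvent_exists assms .
  then have Uy: "U y = x + scale z1 (perp P y)" using x(1) by (simp add: algebra_simps)
  have px: "perp P x = 0" using x(1) by (simp add: perp_def)
  have "y \<noteq> 0" using y x(1,2) by (auto simp: lin_0[OF lin_U] lin_0[OF lin_perp])
  moreover have "perp P (U y) = scale z1 (perp P y)"
    unfolding Uy using lin_perp px by (simp add: lin_iff)
  moreover have "P (U y) = x"
    unfolding Uy using lin_P x(1) by (simp add: lin_iff)
  moreover have "P y = scale z2 x" using char_funI[OF assms y] x(3) by simp
  ultimately show "\<exists>v. v \<noteq> 0 \<and> perp P (U v) = scale z1 (perp P v) \<and> P v = scale z2 (P (U v))"
    by auto
qed

section \<open>A reduced fraction for \<open>char_mat\<close>, by Cramer's rule\<close>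

lemma char_mat_reduced_fraction: "\<exists>F q. reduced_fraction (length es) (char_mat es P U) F q"
proof -
  obtain fs where fs: "orthonormal_basis fs UNIV" using orthonormal_basis_UNIV by blast
  let ?n = "length fs" and ?r = "length es"
  \<comment> \<open>The pencil acts on the whole space, so its matrix is taken in a basis
    \<open>fs\<close> of the whole space, while \<open>es\<close> serves only for the entries of
    \<open>char_mat\<close>.\<close>
  define M where "M z = matrix_of fs (pencil z)" for z
  have M: "M z \<in> carrier_mat ?n ?n" for z by (simp add: M_def)
  have M_poly: "(\<lambda>z. M z $$ (i, j)) \<in> range poly" if "i < ?n" "j < ?n" for i j
  proof -
    have "(\<lambda>z. M z $$ (i, j))
        = (\<lambda>z. ip (fs ! j) (fs ! i) + z * - ip (adj U (perp P (fs ! j))) (fs ! i))"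
      using that by (simp add: M_def matrix_of_def pencil_def ip_diff_left ip_scale_left fun_eq_iff)
    then show ?thesis by (simp only:) (intro range_poly_add range_poly_mult range_poly_const range_poly_id)
  qed
  obtain q where q: "(\<lambda>z. det (M z)) = poly q" using range_poly_det[OF M M_poly] by auto
  have q0: "poly q z \<noteq> 0" if "z \<in> disc" for z
  proof -
    \<comment> \<open>A singular matrix would give the pencil a nonzero kernel vector.\<close>
    have "det (M z) \<noteq> 0"
      unfolding M_def using det_matrix_of_eq_0_iff[OF fs lin_pencil] bij_pencil[OF that]
      by (metis bij_pointE iso_tuple_UNIV_I lin_0 lin_pencil)
    then show ?thesis using fun_cong[OF q, of z] by simp
  qed
  \<comment> \<open>The Cramer numerator for coordinate \<open>k\<close> of the solution
    \<open>y\<close> of \<open>pencil z y = adj U (P (es ! j))\<close>.\<close>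
  define R where "R j k z = det (replace_col (M z) (coords fs (adj U (P (es ! j)))) k)" for j k z
  have "R j k \<in> range poly" if "k < ?n" for j k
    unfolding R_def
  proof (rule range_poly_det[where n = ?n])
    fix i l assume "i < ?n" "l < ?n"
    then show "(\<lambda>z. replace_col (M z) (coords fs (adj U (P (es ! j)))) k $$ (i, l)) \<in> range poly"
      using M_poly[of i l] range_poly_const
      by (cases "l = k") (simp_all add: replace_col_def carrier_matD[OF M])
  qed (simp add: replace_col_def carrier_matD[OF M])
  \<comment> \<open>This is \<open>det (M z)\<close> times the entry
    \<open>ip (P y) (es ! i)\<close> of \<open>char_mat\<close>, with \<open>y\<close> expanded in
    \<open>fs\<close>.\<close>
  then have "(\<lambda>z. \<Sum>k<?n. R j k z * ip (P (fs ! k)) (es ! i)) \<in> range poly" for i j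
    by (intro range_poly_sum range_poly_mult range_poly_const) auto
  then obtain f where f: "\<And>i j. (\<lambda>z. \<Sum>k<?n. R j k z * ip (P (fs ! k)) (es ! i)) = poly (f i j)"
    unfolding image_iff by metis
  define F where "F = mat ?r ?r (\<lambda>(i, j). f i j)"
  show ?thesis
  proof (rule reduced_fraction_exists[of F _ _ q])
    show "F \<in> carrier_mat ?r ?r" by (simp add: F_def)
    show "char_mat es P U z \<in> carrier_mat ?r ?r" for z by (simp add: char_mat_def)
    fix z :: complex assume z: "z \<in> disc"
    then show "poly q z \<noteq> 0" by (rule q0)
    show "poly q z \<cdot>\<^sub>m char_mat es P U z = eval_mat F z"
    proof (rule eq_matI)
      fix i j assume "i < dim_row (eval_mat F z)" "j < dim_col (eval_mat F z)"
      then have ij: "i < ?r" "j < ?r" by (auto simp: F_def)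
      define y where "y = inv_into UNIV (pencil z) (adj U (P (es ! j)))"
      have "pencil z y = adj U (P (es ! j))"
        unfolding y_def using bij_pencil[OF z] by (simp add: bij_is_surj surj_f_inv_f)
      then have My: "M z *\<^sub>v coords fs y = coords fs (adj U (P (es ! j)))"
        unfolding M_def using matrix_of_mult_coords[OF fs _ lin_pencil] by simp
      have R: "R j k z = ip y (fs ! k) * poly q z" if "k < ?n" for k
        using cramer_lemma_mat[OF M coords_carrier that, of z y] that fun_cong[OF q, of z]
        unfolding R_def My by (simp add: coords_def)
      have "P y = (\<Sum>k<?n. scale (ip y (fs ! k)) (P (fs ! k)))"
        using arg_cong[OF orthonormal_expansion[OF fs UNIV_I], of P y] lin_P
        by (simp add: lin_sum lin_iff)
      then have "poly q z * ip (P y) (es ! i) = (\<Sum>k<?n. R j k z * ip (P (fs ! k)) (es ! i))"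
        by (simp add: ip_sum_left ip_scale_left sum_distrib_left R algebra_simps)
      also have "\<dots> = poly (f i j) z" using fun_cong[OF f] by simp
      finally show "(poly q z \<cdot>\<^sub>m char_mat es P U z) $$ (i, j) = eval_mat F z $$ (i, j)"
        using ij by (simp add: F_def char_mat_def matrix_of_def char_fun_eq y_def)
    qed (simp_all add: F_def char_mat_def matrix_of_def)
  qed
qed

text \<open>For \<open>z1\<close> in the disc both memberships say that
  \<open>\<Psi>(z1) - z2\<close> has a nonzero null vector in \<open>range P\<close>: one by the
  eigenvector description, the other by the determinant in the basis \<open>es\<close>. If
  \<open>P\<close> is zero, \<open>es\<close> is empty, the determinant is 1 and both sides are
  empty.\<close>

lemma model_variety_eq_variety_of_char_mat:
  assumes es: "orthonormal_basis es (range P)"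
  shows "model_variety P U \<inter> bidisc = variety_of_inner (length es) (char_mat es P U) \<inter> bidisc"
proof -
  have "(z1, z2) \<in> model_variety P U \<longleftrightarrow> (z1, z2) \<in> variety_of_inner (length es) (char_mat es P U)"
    if z1: "z1 \<in> disc" for z1 z2
  proof -
    have lin: "lin (\<lambda>x. char_fun P U z1 x - scale z2 x)"
      using lin_char_fun[OF z1] unfolding lin_iff
      by (simp add: scale_right_distrib scale_right_diff_distrib mult.commute)
    have "char_fun P U z1 x - scale z2 x \<in> range P" if "x \<in> range P" for x
    proof -
      have "char_fun P U z1 x - scale z2 x = P (char_fun P U z1 x - scale z2 x)"
        using that lin_P by (auto simp: char_fun_eq lin_diff lin_iff)
      then show ?thesis by (rule range_eqI)
    qed
    then have "(z1, z2) \<in> model_variety P U \<longleftrightarrow>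
        det (matrix_of es (\<lambda>x. char_fun P U z1 x - scale z2 x)) = 0"
      using det_matrix_of_eq_0_iff[OF es lin] model_variety_iff_char_fun[OF z1] by simp
    also have "\<dots> \<longleftrightarrow> (z1, z2) \<in> variety_of_inner (length es) (char_mat es P U)"
      using variety_of_inner_iff[OF char_mat_reduced_fraction z1, of es] matrix_of_diff_scale[OF es]
      by (simp add: char_mat_def)
    finally show ?thesis .
  qed
  then show ?thesis by auto
qed

end

text \<open>Comparing row counts at one point of the disc identifies \<open>r\<close> with
  \<open>length es\<close> in the second claim.\<close>

lemma rational_inner_carrier:
  assumes "rational_inner r \<Psi>" "z \<in> disc"
  shows "dim_row (\<Psi> z) = r"
  using assms unfolding rational_inner_def by fastforce

theorem theorem4p2:
  fixes W :: "(complex \<times> complex) set"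
  assumes "distinguished_variety W"
  shows
    "(\<forall>(sc :: complex \<Rightarrow> 'a::ab_group_add \<Rightarrow> 'a) ip P U.
        finite_model_triple sc ip P U \<longrightarrow>
        W \<inter> bidisc = fd_hilbert_space.model_variety sc ip P U \<inter> bidisc \<longrightarrow>
        (\<forall>es. fd_hilbert_space.orthonormal_basis sc ip es (range P) \<longrightarrow>
           W \<inter> bidisc =
             variety_of_inner (length es) (fd_hilbert_space.char_mat sc ip es P U) \<inter> bidisc)) \<and>
     (\<forall>r \<Psi>. rational_inner r \<Psi> \<longrightarrow> W \<inter> bidisc = variety_of_inner r \<Psi> \<inter> bidisc \<longrightarrow>
        (\<forall>(sc :: complex \<Rightarrow> 'a::ab_group_add \<Rightarrow> 'a) ip P U.
           finite_model_triple sc ip P U \<longrightarrow>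
           (\<exists>es. fd_hilbert_space.orthonormal_basis sc ip es (range P) \<and>
              (\<forall>z\<in>disc. \<Psi> z = fd_hilbert_space.char_mat sc ip es P U z)) \<longrightarrow>
           W \<inter> bidisc = fd_hilbert_space.model_variety sc ip P U \<inter> bidisc))"
proof -
  \<comment> \<open>Both claims rest on this one equality. In the second,
    \<open>variety_of_inner_cong\<close> first replaces \<open>\<Psi>\<close> by
    \<open>char_mat\<close>, with which it agrees on the disc.\<close>
  have main: "fd_hilbert_space.model_variety sc ip P U \<inter> bidisc
      = variety_of_inner (length es) (fd_hilbert_space.char_mat sc ip es P U) \<inter> bidisc"
    if "finite_model_triple sc ip P U" "fd_hilbert_space.orthonormal_basis sc ip es (range P)"
    for sc :: "complex \<Rightarrow> 'a \<Rightarrow> 'a" and ip P U es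
    using that model_triple.model_variety_eq_variety_of_char_mat[of sc ip P U es]
    unfolding finite_model_triple_def model_triple_def model_triple_axioms_def by blast
  have "W \<inter> bidisc = fd_hilbert_space.model_variety sc ip P U \<inter> bidisc"
    if \<Psi>: "rational_inner r \<Psi>" "W \<inter> bidisc = variety_of_inner r \<Psi> \<inter> bidisc"
      and m: "finite_model_triple sc ip P U"
      and es: "fd_hilbert_space.orthonormal_basis sc ip es (range P)"
      and eq: "\<And>z. z \<in> disc \<Longrightarrow> \<Psi> z = fd_hilbert_space.char_mat sc ip es P U z"
    for r \<Psi> es and sc :: "complex \<Rightarrow> 'a \<Rightarrow> 'a" and ip P U
  proof -
    interpret fd_hilbert_space sc ip using m unfolding finite_model_triple_def by blast
    have "r = length es"
      using rational_inner_carrier[OF \<Psi>(1), of 0] eq[of 0] by (simp add: char_mat_def matrix_of_def)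
    then show ?thesis
      using \<Psi>(2) main[OF m es] variety_of_inner_cong[OF eq] by simp
  qed
  then show ?thesis using main by (intro conjI allI impI; (elim exE conjE)?) simp_all
qed

end
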